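(* Let $N\ge2$ be an integer and let the real coefficients satisfy $$z_1\le \cdots\le z_l<0<z_{l+1}\le\cdots\le z_N\quad\text{for some integer }1\le l\le N-1,\qquad k_B,\nu_i,k,\varepsilon,\lambda_0,\rho_0,c_0,c_i>0\ (1\le i\le N).$$ Let $\nu:=\dfrac{N}{\sum_{j=1}^N\frac1{\nu_j}}$ and assume $$\max_{1\le i\le N}\Big(1-\frac{\nu_i}{\nu}\Big)^2<\frac12 .$$ Then the equilibria set $\mathcal S_{eq}\subseteq\mathbb R^N$ (defined in the context) is nonempty: $\mathcal S_{eq}\neq\emptyset$.
   Context: For $(\delta_1,\dots,\delta_N)$ put $b=k+\sum_{i=1}^N\frac{k_B^2\delta_i}{\nu_i}$. The equilibria set $\mathcal S_{eq}$ is the set of $(\delta_1,\dots,\delta_N)\in\mathbb R^N$ such that: (A1) $\delta_i>0$ for all $1\le i\le N$ and $\sum_{i=1}^Nz_i\delta_i=0$; (A2) there are positive constants $\chi_i,\eta_i,\eta_i',\eta_{\phi i}$ $(1\le i\le N)$, $\chi_m,\eta_m,\eta_m',\eta_\theta,\eta_\theta',\eta_\phi,\chi_\phi,\chi_\theta$ (possibly depending on the $\delta_i$) such that (H1) $\chi_\theta(1-\eta_\theta-\eta_\theta')b-\chi_m\frac{k_B\nu}{4\eta_m'}\big(\sum_{i=1}^N\frac{z_i\delta_i}{\nu_i}\big)^2-\sum_{i=1}^N\chi_i\frac{k_B\delta_i^2}{4\eta_i\nu_i}-\chi_\phi\frac{k_B^2}{4\eta_\phi}\big(\sum_{i=1}^N\frac{z_i\delta_i}{\nu_i}\big)^2>0$;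 (H2) $1-\eta_m-\eta_m'>0$; (H3) $\chi_\phi\big(\sum_{i=1}^N\frac{z_i^2\delta_i}{\nu_i}-\sum_{i=1}^N\eta_{\phi i}-\eta_\phi\big)-\chi_\theta\frac{k_B^2}{4\eta_\theta'b}\big(\sum_{i=1}^N\frac{z_i\delta_i}{\nu_i}\big)^2-\sum_{i=1}^N\chi_i\frac{z_i^2\delta_i^2}{4\eta_i'k_B\nu_i}>0$; (H4) for every $1\le i\le N$: $\chi_i(1-\eta_i-\eta_i')\frac{k_B}{\nu_i}-\chi_\theta\frac{Nk_B^4}{4\eta_\theta b\nu_i}-\chi_m\frac{k_B\nu z_i^2}{4\eta_m}\big(\frac1{\nu_i}-\frac1\nu\big)^2-\chi_\phi\frac{k_B^2z_i^2}{4\eta_{\phi i}}\big(\frac1{\nu_i}-\frac1\nu\big)^2>0$. *)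

theory Defs
  imports Complex_Main "HOL-Library.FuncSet"
begin

definition harmonic_mean :: "nat \<Rightarrow> (nat \<Rightarrow> real) \<Rightarrow> real" where
  "harmonic_mean N \<nu> = real N / (\<Sum>j=1..N. 1 / \<nu> j)"

definition heat_coeff :: "nat \<Rightarrow> real \<Rightarrow> real \<Rightarrow> (nat \<Rightarrow> real) \<Rightarrow> (nat \<Rightarrow> real) \<Rightarrow> real" where
  "heat_coeff N k\<^sub>B k \<nu> \<delta> = k + (\<Sum>i=1..N. k\<^sub>B\<^sup>2 * \<delta> i / \<nu> i)"

text \<open>
  Points of the Euclidean space of dimension \<open>N\<close> are the functions extensional on \<open>{1..N}\<close>;
  values outside this index set carry no information. The families \<open>\<chi>\<close>, \<open>\<eta>\<close>, \<open>\<eta>'\<close>, \<open>\<eta>\<phi>s\<close>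
  are indexed by the species \<open>i\<close>, where \<open>\<eta>\<phi>s i\<close> is the constant with double index \<open>\<phi> i\<close>,
  not to be confused with the scalar \<open>\<eta>\<phi>\<close>. In the scalar names, the letters \<open>m\<close>, \<open>\<theta>\<close>, \<open>\<phi>\<close>
  after \<open>\<chi>\<close> or \<open>\<eta>\<close> are subscripts.
\<close>
definition equilibria_set ::
  "nat \<Rightarrow> real \<Rightarrow> real \<Rightarrow> (nat \<Rightarrow> real) \<Rightarrow> (nat \<Rightarrow> real) \<Rightarrow> (nat \<Rightarrow> real) set" where
  "equilibria_set N k\<^sub>B k z \<nu> = {\<delta> \<in> extensional {1..N}.
     (\<forall>i\<in>{1..N}. \<delta> i > 0) \<and> (\<Sum>i=1..N. z i * \<delta> i) = 0 \<and>
     (let b = heat_coeff N k\<^sub>B k \<nu> \<delta>;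
          \<nu>h = harmonic_mean N \<nu>;
          S = (\<Sum>i=1..N. z i * \<delta> i / \<nu> i)
      in \<exists>(\<chi> :: nat \<Rightarrow> real) (\<eta> :: nat \<Rightarrow> real) (\<eta>' :: nat \<Rightarrow> real) (\<eta>\<phi>s :: nat \<Rightarrow> real)
           (\<chi>m :: real) (\<eta>m :: real) (\<eta>m' :: real) (\<eta>\<theta> :: real) (\<eta>\<theta>' :: real)
           (\<eta>\<phi> :: real) (\<chi>\<phi> :: real) (\<chi>\<theta> :: real).
         (\<forall>i\<in>{1..N}. \<chi> i > 0 \<and> \<eta> i > 0 \<and> \<eta>' i > 0 \<and> \<eta>\<phi>s i > 0) \<and>
         \<chi>m > 0 \<and> \<eta>m > 0 \<and> \<eta>m' > 0 \<and> \<eta>\<theta> > 0 \<and> \<eta>\<theta>' > 0 \<and> \<eta>\<phi> > 0 \<and> \<chi>\<phi> > 0 \<and> \<chi>\<theta> > 0 \<and>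
         \<chi>\<theta> * (1 - \<eta>\<theta> - \<eta>\<theta>') * b
           - \<chi>m * (k\<^sub>B * \<nu>h / (4 * \<eta>m')) * S\<^sup>2
           - (\<Sum>i=1..N. \<chi> i * (k\<^sub>B * (\<delta> i)\<^sup>2 / (4 * \<eta> i * \<nu> i)))
           - \<chi>\<phi> * (k\<^sub>B\<^sup>2 / (4 * \<eta>\<phi>)) * S\<^sup>2 > 0 \<and>
         1 - \<eta>m - \<eta>m' > 0 \<and>
         \<chi>\<phi> * ((\<Sum>i=1..N. (z i)\<^sup>2 * \<delta> i / \<nu> i) - (\<Sum>i=1..N. \<eta>\<phi>s i) - \<eta>\<phi>)
           - \<chi>\<theta> * (k\<^sub>B\<^sup>2 / (4 * \<eta>\<theta>' * b)) * S\<^sup>2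
           - (\<Sum>i=1..N. \<chi> i * ((z i)\<^sup>2 * (\<delta> i)\<^sup>2 / (4 * \<eta>' i * k\<^sub>B * \<nu> i))) > 0 \<and>
         (\<forall>i\<in>{1..N}.
            \<chi> i * (1 - \<eta> i - \<eta>' i) * (k\<^sub>B / \<nu> i)
              - \<chi>\<theta> * (real N * k\<^sub>B ^ 4 / (4 * \<eta>\<theta> * b * \<nu> i))
              - \<chi>m * (k\<^sub>B * \<nu>h * (z i)\<^sup>2 / (4 * \<eta>m)) * (1 / \<nu> i - 1 / \<nu>h)\<^sup>2
              - \<chi>\<phi> * (k\<^sub>B\<^sup>2 * (z i)\<^sup>2 / (4 * \<eta>\<phi>s i)) * (1 / \<nu> i - 1 / \<nu>h)\<^sup>2 > 0))}"

end

theory Submission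
  imports Defs
begin

text \<open>
  Equilibria are found along a ray \<open>\<delta> = t d\<close> with \<open>d\<close> a fixed positive vector of zero total charge
  and \<open>t\<close> small. Take \<open>\<chi>\<theta> = \<chi>m = \<chi>\<phi> = 1\<close> but \<open>\<chi> i\<close> of order \<open>1 / \<delta> i\<close>, and choose \<open>\<eta>\<phi>s i\<close>
  and \<open>\<eta>\<phi>\<close> as fixed fractions of \<open>(z i)\<^sup>2 \<delta> i / \<nu> i\<close> and of its sum \<open>D\<close>. As \<open>t\<close> tends to \<open>0\<close>
  the heat coefficient dominates (H1). In (H3) and (H4) the terms of leading order, \<open>t\<close> and \<open>1 / t\<close>
  respectively, have a positive total; in (H4) this uses the bound \<open>1 / 2\<close> on \<open>(1 - \<nu> i / \<nu>h)\<^sup>2\<close>.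
\<close>

text \<open>Each negative \<open>z i\<close> is weighted by the total of the nonnegative ones, every
  other \<open>z i\<close> by minus the total of the negative ones. The two halves of the weighted
  sum are then plus and minus the same product of totals. The indices \<open>p\<close> and
  \<open>q\<close> keep both totals, hence all weights, away from zero.\<close>

lemma exists_pos_weights_sum_zero:
  fixes z :: "'a \<Rightarrow> real"
  assumes "finite I" and nz: "\<And>i. i \<in> I \<Longrightarrow> z i \<noteq> 0"
    and "p \<in> I" "z p < 0" "q \<in> I" "0 < z q"
  shows "\<exists>d. (\<forall>i\<in>I. d i > 0) \<and> (\<Sum>i\<in>I. z i * d i) = 0"
proof -
  define A where "A = {i\<in>I. z i < 0}"
  define B where "B = {i\<in>I. \<not> z i < 0}"
  define d where "d i = (if z i < 0 then sum z B else - sum z A)" for i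
  have fin: "finite A" "finite B" and IAB: "I = A \<union> B" "A \<inter> B = {}"
    using \<open>finite I\<close> by (auto simp: A_def B_def)
  have "sum z B > 0"
    by (rule sum_pos2[of B q]) (use fin assms in \<open>auto simp: B_def\<close>)
  moreover have "(\<Sum>i\<in>A. - z i) > 0"
    by (rule sum_pos2[of A p]) (use fin assms in \<open>auto simp: A_def\<close>)
  ultimately have pos: "\<forall>i\<in>I. d i > 0"
    by (auto simp: d_def sum_negf)
  have "(\<Sum>i\<in>I. z i * d i) = (\<Sum>i\<in>A. z i * d i) + (\<Sum>i\<in>B. z i * d i)"
    unfolding IAB(1) by (rule sum.union_disjoint) (use fin IAB(2) in auto)
  also have "(\<Sum>i\<in>A. z i * d i) = (\<Sum>i\<in>A. z i * sum z B)"
    by (rule sum.cong) (auto simp: A_def d_def)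
  also have "(\<Sum>i\<in>B. z i * d i) = (\<Sum>i\<in>B. z i * (- sum z A))"
    by (rule sum.cong) (auto simp: B_def d_def)
  finally have "(\<Sum>i\<in>I. z i * d i) = 0"
    by (simp only: sum_distrib_right[symmetric]) simp
  with pos show ?thesis by blast
qed

text \<open>After a fixed choice of the auxiliary constants, and with \<open>k\<close> as lower
  bound of the heat coefficient, (H1), (H3) and (H4) follow from \<open>small1\<close>,
  \<open>small3\<close> and \<open>small4\<close>. Each right-hand side is the margin that the
  leading terms leave: \<open>k/2\<close>, \<open>D/16\<close>, and
  \<open>k\<^sub>B\<^sup>2 / 32\<close> once (H4) is multiplied by
  \<open>\<delta> i * \<nu> i\<close>.\<close>

lemma equilibria_setI:
  fixes N :: nat and z \<nu> \<delta> :: "nat \<Rightarrow> real" and k\<^sub>B k :: real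
  defines "\<nu>h \<equiv> harmonic_mean N \<nu>"
    and "S \<equiv> (\<Sum>i=1..N. z i * \<delta> i / \<nu> i)"
    and "D \<equiv> (\<Sum>i=1..N. (z i)\<^sup>2 * \<delta> i / \<nu> i)"
  assumes "N \<ge> 1" and kB: "k\<^sub>B > 0" and k: "k > 0"
    and nu: "\<And>i. i \<in> {1..N} \<Longrightarrow> \<nu> i > 0"
    and z: "\<And>i. i \<in> {1..N} \<Longrightarrow> z i \<noteq> 0"
    and close: "\<And>i. i \<in> {1..N} \<Longrightarrow> (1 - \<nu> i / \<nu>h)\<^sup>2 < 1/2"
    and ext: "\<delta> \<in> extensional {1..N}"
    and pos: "\<And>i. i \<in> {1..N} \<Longrightarrow> \<delta> i > 0"
    and neutral: "(\<Sum>i=1..N. z i * \<delta> i) = 0"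
    and small1: "k\<^sub>B * \<nu>h * S\<^sup>2 + 3/2 * k\<^sub>B\<^sup>2 * (\<Sum>i=1..N. \<delta> i / \<nu> i) + 4 * k\<^sub>B\<^sup>2 * S\<^sup>2 / D < k/2"
    and small3: "k\<^sub>B\<^sup>2 * S\<^sup>2 / k < D/16"
    and small4: "\<And>i. i \<in> {1..N} \<Longrightarrow>
      \<delta> i * (real N * k\<^sub>B^4 / k + k\<^sub>B * \<nu>h * (z i)\<^sup>2 / (2 * \<nu> i)) < k\<^sub>B\<^sup>2 / 32"
  shows "\<delta> \<in> equilibria_set N k\<^sub>B k z \<nu>"
proof -
  define b where "b = heat_coeff N k\<^sub>B k \<nu> \<delta>"
  have "0 \<le> (\<Sum>i=1..N. k\<^sub>B\<^sup>2 * \<delta> i / \<nu> i)"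
    by (rule sum_nonneg) (use nu pos in \<open>simp add: less_imp_le\<close>)
  then have bk: "b \<ge> k" and b: "b > 0"
    using k by (auto simp: b_def heat_coeff_def)
  have D: "D > 0"
    unfolding D_def by (rule sum_pos) (use \<open>N \<ge> 1\<close> nu pos z in auto)
  have "(\<Sum>j=1..N. 1 / \<nu> j) > 0"
    by (rule sum_pos) (use \<open>N \<ge> 1\<close> nu in auto)
  then have nuh: "\<nu>h > 0"
    using \<open>N \<ge> 1\<close> by (simp add: \<nu>h_def harmonic_mean_def)

  \<comment> \<open>With 1/8 for \<open>\<eta> i\<close>, 1/2 for \<open>\<eta>' i\<close> and the
    two choices below, the value \<open>c * k\<^sub>B / \<delta> i\<close> costs
    \<open>c/2 * D\<close> out of \<open>7/16 * D\<close> in (H3), and in (H4) contributes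
    \<open>3/8 * c * k\<^sub>B\<^sup>2\<close>, which has to exceed
    \<open>k\<^sub>B\<^sup>2 / 4\<close>. Any \<open>c\<close> strictly between 2/3 and 7/8 would
    do; here it is 3/4.\<close>
  define \<chi> where "\<chi> i = 3 * k\<^sub>B / (4 * \<delta> i)" for i
  define \<eta>\<phi>s where "\<eta>\<phi>s i = ((z i)\<^sup>2 * \<delta> i / \<nu> i) / 2" for i
  \<comment> \<open>Proportionality to \<open>D\<close> turns the last term of (H1) into a multiple
    of \<open>S\<^sup>2 / D\<close>, which is still linear under scaling of
    \<open>\<delta>\<close>.\<close>
  define \<eta>\<phi> where "\<eta>\<phi> = D / 16"

  \<comment> \<open>The factor \<open>1 / \<delta> i\<close> in \<open>\<chi> i\<close> cancels only
    one power of \<open>\<delta> i\<close>, so this sum still vanishes with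
    \<open>\<delta>\<close>.\<close>
  have "(\<Sum>i=1..N. \<chi> i * (k\<^sub>B * (\<delta> i)\<^sup>2 / (4 * (1/8) * \<nu> i)))
      = 3/2 * k\<^sub>B\<^sup>2 * (\<Sum>i=1..N. \<delta> i / \<nu> i)"
    unfolding sum_distrib_left
  proof (rule sum.cong[OF refl])
    fix i assume "i \<in> {1..N}"
    with pos[of i] nu[of i]
    show "\<chi> i * (k\<^sub>B * (\<delta> i)\<^sup>2 / (4 * (1/8) * \<nu> i)) = 3/2 * k\<^sub>B\<^sup>2 * (\<delta> i / \<nu> i)"
      by (simp add: \<chi>_def field_simps power2_eq_square)
  qed
  moreover have "1 * (k\<^sub>B\<^sup>2 / (4 * \<eta>\<phi>)) * S\<^sup>2 = 4 * k\<^sub>B\<^sup>2 * S\<^sup>2 / D"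
    using D by (simp add: \<eta>\<phi>_def field_simps)
  \<comment> \<open>The first term equals \<open>b/2\<close>, hence is at least
    \<open>k/2\<close>.\<close>
  ultimately have H1: "1 * (1 - 1/4 - 1/4) * b - 1 * (k\<^sub>B * \<nu>h / (4 * (1/4))) * S\<^sup>2
      - (\<Sum>i=1..N. \<chi> i * (k\<^sub>B * (\<delta> i)\<^sup>2 / (4 * (1/8) * \<nu> i)))
      - 1 * (k\<^sub>B\<^sup>2 / (4 * \<eta>\<phi>)) * S\<^sup>2 > 0"
    using small1 bk by simp

  have "(\<Sum>i=1..N. \<chi> i * ((z i)\<^sup>2 * (\<delta> i)\<^sup>2 / (4 * (1/2) * k\<^sub>B * \<nu> i))) = 3/8 * D"
    unfolding D_def sum_distrib_left
  proof (rule sum.cong[OF refl])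
    fix i assume "i \<in> {1..N}"
    with pos[of i] nu[of i] kB
    show "\<chi> i * ((z i)\<^sup>2 * (\<delta> i)\<^sup>2 / (4 * (1/2) * k\<^sub>B * \<nu> i)) = 3/8 * ((z i)\<^sup>2 * \<delta> i / \<nu> i)"
      by (simp add: \<chi>_def field_simps power2_eq_square)
  qed
  moreover have "(\<Sum>i=1..N. \<eta>\<phi>s i) = D / 2"
    by (simp add: D_def \<eta>\<phi>s_def sum_divide_distrib)
  moreover have "k\<^sub>B\<^sup>2 / (4 * (1/4) * b) * S\<^sup>2 \<le> k\<^sub>B\<^sup>2 * S\<^sup>2 / k"
    using divide_left_mono[OF bk, of "k\<^sub>B\<^sup>2 * S\<^sup>2"] b k by simp
  \<comment> \<open>The multiples of \<open>D\<close> add up to 1 - 1/2 - 1/16 - 3/8 = 1/16.\<close>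
  ultimately have H3: "1 * (D - (\<Sum>i=1..N. \<eta>\<phi>s i) - \<eta>\<phi>)
      - 1 * (k\<^sub>B\<^sup>2 / (4 * (1/4) * b)) * S\<^sup>2
      - (\<Sum>i=1..N. \<chi> i * ((z i)\<^sup>2 * (\<delta> i)\<^sup>2 / (4 * (1/2) * k\<^sub>B * \<nu> i))) > 0"
    using small3 by (simp add: \<eta>\<phi>_def)

  have H4: "\<chi> i * (1 - 1/8 - 1/2) * (k\<^sub>B / \<nu> i)
      - 1 * (real N * k\<^sub>B ^ 4 / (4 * (1/4) * b * \<nu> i))
      - 1 * (k\<^sub>B * \<nu>h * (z i)\<^sup>2 / (4 * (1/4))) * (1 / \<nu> i - 1 / \<nu>h)\<^sup>2
      - 1 * (k\<^sub>B\<^sup>2 * (z i)\<^sup>2 / (4 * \<eta>\<phi>s i)) * (1 / \<nu> i - 1 / \<nu>h)\<^sup>2 > 0"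
    if i: "i \<in> {1..N}" for i
  proof -
    note p = pos[OF i] nu[OF i] z[OF i]
    define a where "a = (1 - \<nu> i / \<nu>h)\<^sup>2"
    have a: "a < 1/2" using close[OF i] by (simp add: a_def)
    \<comment> \<open>Factoring out \<open>1 / \<nu> i\<close> exposes the quantity bounded in
      \<open>close\<close>.\<close>
    have "1 / \<nu> i - 1 / \<nu>h = (1 - \<nu> i / \<nu>h) / \<nu> i"
      using p nuh by (simp add: field_simps)
    then have sq: "(1 / \<nu> i - 1 / \<nu>h)\<^sup>2 = a / (\<nu> i)\<^sup>2"
      by (simp add: a_def power_divide)
    \<comment> \<open>From here on every term of (H4) is put over
      \<open>\<delta> i * \<nu> i\<close>, so that only numerators have to be compared.\<close>
    have t1: "\<chi> i * (1 - 1/8 - 1/2) * (k\<^sub>B / \<nu> i) = (9/32 * k\<^sub>B\<^sup>2) / (\<delta> i * \<nu> i)"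
      using p by (simp add: \<chi>_def field_simps power2_eq_square)
    have "real N * k\<^sub>B ^ 4 / (4 * (1/4) * b * \<nu> i) = \<delta> i * (real N * k\<^sub>B ^ 4 / b) / (\<delta> i * \<nu> i)"
      using p b by (simp add: field_simps)
    also have "\<dots> \<le> \<delta> i * (real N * k\<^sub>B ^ 4 / k) / (\<delta> i * \<nu> i)"
      by (intro divide_right_mono mult_left_mono divide_left_mono) (use p b k bk kB in auto)
    finally have t2: "real N * k\<^sub>B ^ 4 / (4 * (1/4) * b * \<nu> i)
        \<le> \<delta> i * (real N * k\<^sub>B ^ 4 / k) / (\<delta> i * \<nu> i)" .
    have "(k\<^sub>B * \<nu>h * (z i)\<^sup>2 / (4 * (1/4))) * (a / (\<nu> i)\<^sup>2)
        = \<delta> i * (k\<^sub>B * \<nu>h * (z i)\<^sup>2 / \<nu> i * a) / (\<delta> i * \<nu> i)"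
      using p by (simp add: field_simps power2_eq_square)
    also have "\<dots> \<le> \<delta> i * (k\<^sub>B * \<nu>h * (z i)\<^sup>2 / \<nu> i * (1/2)) / (\<delta> i * \<nu> i)"
      by (intro divide_right_mono mult_left_mono) (use p a nuh kB in auto)
    finally have t3: "(k\<^sub>B * \<nu>h * (z i)\<^sup>2 / (4 * (1/4))) * (a / (\<nu> i)\<^sup>2)
        \<le> \<delta> i * (k\<^sub>B * \<nu>h * (z i)\<^sup>2 / (2 * \<nu> i)) / (\<delta> i * \<nu> i)"
      by (simp only: times_divide_times_eq mult_1_right mult.commute[of _ 2])
    \<comment> \<open>This is the only subtracted term of the same order as \<open>t1\<close>:
      smallness of \<open>\<delta>\<close> does not help, and \<open>a < 1/2\<close> must bring it
      below 9/32.\<close>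
    have "(k\<^sub>B\<^sup>2 * (z i)\<^sup>2 / (4 * \<eta>\<phi>s i)) * (a / (\<nu> i)\<^sup>2) = (k\<^sub>B\<^sup>2 / 2 * a) / (\<delta> i * \<nu> i)"
      using p by (simp add: \<eta>\<phi>s_def field_simps power2_eq_square)
    also have "\<dots> \<le> (k\<^sub>B\<^sup>2 / 2 * (1/2)) / (\<delta> i * \<nu> i)"
      by (intro divide_right_mono mult_left_mono) (use p a in auto)
    finally have t4: "(k\<^sub>B\<^sup>2 * (z i)\<^sup>2 / (4 * \<eta>\<phi>s i)) * (a / (\<nu> i)\<^sup>2)
        \<le> (k\<^sub>B\<^sup>2 / 4) / (\<delta> i * \<nu> i)"
      by simp
    \<comment> \<open>The margin in \<open>small4\<close> is 9/32 - 1/4 = 1/32.\<close>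
    have "0 < (9/32 * k\<^sub>B\<^sup>2 - \<delta> i * (real N * k\<^sub>B ^ 4 / k)
        - \<delta> i * (k\<^sub>B * \<nu>h * (z i)\<^sup>2 / (2 * \<nu> i)) - k\<^sub>B\<^sup>2 / 4) / (\<delta> i * \<nu> i)"
      using small4[OF i, unfolded distrib_left] p by (intro divide_pos_pos mult_pos_pos; linarith)
    then show ?thesis
      unfolding sq t1 mult_1_left diff_divide_distrib
      by (rule less_le_trans) (intro diff_mono order_refl t2 t3 t4)
  qed

  have pos': "\<forall>i\<in>{1..N}. \<chi> i > 0 \<and> (1/8::real) > 0 \<and> (1/2::real) > 0 \<and> \<eta>\<phi>s i > 0"
    using pos nu z kB by (auto simp: \<chi>_def \<eta>\<phi>s_def)
  have "\<eta>\<phi> > 0" using D by (simp add: \<eta>\<phi>_def)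
  show ?thesis
    unfolding equilibria_set_def Let_def mem_Collect_eq
      \<nu>h_def[symmetric] S_def[symmetric] D_def[symmetric] b_def[symmetric]
    apply (intro conjI ext neutral)
     apply (use pos in blast)
    \<comment> \<open>The witnesses follow the order of the quantifiers: the scalar
      \<open>\<chi>\<close> constants are 1 and the scalar \<open>\<eta>\<close> constants other
      than \<open>\<eta>\<phi>\<close> are 1/4. Thus (H2) reads 1 - 1/4 - 1/4 > 0 and is left to
      \<open>simp\<close>.\<close>
    apply (rule exI[of _ \<chi>], rule exI[of _ "\<lambda>_. 1/8"], rule exI[of _ "\<lambda>_. 1/2"], rule exI[of _ \<eta>\<phi>s],
        rule exI[of _ 1], rule exI[of _ "1/4"], rule exI[of _ "1/4"], rule exI[of _ "1/4"],
        rule exI[of _ "1/4"], rule exI[of _ \<eta>\<phi>], rule exI[of _ 1], rule exI[of _ 1])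
    apply (intro conjI pos' H1 H3 ballI H4 \<open>\<eta>\<phi> > 0\<close>)
             apply simp_all
    done
qed

lemma eventually_mult_less_at_right_0:
  fixes C e :: real
  assumes "e > 0"
  shows "eventually (\<lambda>t. t * C < e) (at_right 0)"
proof -
  have "((\<lambda>t. t * C) \<longlongrightarrow> 0 * C) (at_right 0)"
    by (intro tendsto_intros)
  then show ?thesis using assms by (auto dest: order_tendstoD(2))
qed

theorem proposition2p1:
  fixes N :: nat
    and z \<nu> c :: "nat \<Rightarrow> real"
    and k\<^sub>B k \<epsilon> lam\<^sub>0 \<rho>\<^sub>0 :: real
  assumes "N \<ge> 2"
    and "\<exists>l. 1 \<le> l \<and> l \<le> N - 1 \<and> mono_on {1..l} z \<and> z l < 0 \<and> 0 < z (l + 1) \<and> mono_on {l+1..N} z"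
    and "k\<^sub>B > 0" and "k > 0" and "\<epsilon> > 0" and "lam\<^sub>0 > 0" and "\<rho>\<^sub>0 > 0" and "c 0 > 0"
    and "\<forall>i\<in>{1..N}. \<nu> i > 0 \<and> c i > 0"
    and "Max ((\<lambda>i. (1 - \<nu> i / harmonic_mean N \<nu>)\<^sup>2) ` {1..N}) < 1 / 2"
  shows "equilibria_set N k\<^sub>B k z \<nu> \<noteq> {}"
proof -
  obtain l where l: "1 \<le> l" "l \<le> N - 1" "mono_on {1..l} z" "z l < 0" "0 < z (l + 1)"
    "mono_on {l+1..N} z"
    using assms(2) by blast
  have z: "z i \<noteq> 0" if "i \<in> {1..N}" for i
  proof (cases "i \<le> l")
    case True
    then have "z i \<le> z l" using that l by (intro mono_onD[OF l(3)]) auto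
    then show ?thesis using l(4) by simp
  next
    case False
    then have "z (l + 1) \<le> z i" using that l by (intro mono_onD[OF l(6)]) auto
    then show ?thesis using l(5) by simp
  qed
  have "l \<in> {1..N}" "l + 1 \<in> {1..N}" using l \<open>N \<ge> 2\<close> by auto
  then have "\<exists>d. (\<forall>i\<in>{1..N}. d i > 0) \<and> (\<Sum>i=1..N. z i * d i) = 0"
    using z l(4,5) by (intro exists_pos_weights_sum_zero) auto
  then obtain d where d: "\<And>i. i \<in> {1..N} \<Longrightarrow> d i > 0" "(\<Sum>i=1..N. z i * d i) = 0"
    by blast
  define \<nu>h where "\<nu>h = harmonic_mean N \<nu>"
  define S where "S = (\<Sum>i=1..N. z i * d i / \<nu> i)"
  define D where "D = (\<Sum>i=1..N. (z i)\<^sup>2 * d i / \<nu> i)"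
  define F where "F = (\<Sum>i=1..N. d i / \<nu> i)"
  have nu: "\<nu> i > 0" if "i \<in> {1..N}" for i using assms(9) that by blast
  have D: "D > 0"
    unfolding D_def by (rule sum_pos) (use \<open>N \<ge> 2\<close> nu d z in auto)
  have close: "(1 - \<nu> i / harmonic_mean N \<nu>)\<^sup>2 < 1/2" if "i \<in> {1..N}" for i
  proof -
    have "(1 - \<nu> i / harmonic_mean N \<nu>)\<^sup>2 \<le> Max ((\<lambda>i. (1 - \<nu> i / harmonic_mean N \<nu>)\<^sup>2) ` {1..N})"
      by (rule Max_ge) (use that in auto)
    then show ?thesis using assms(10) by linarith
  qed

  \<comment> \<open>\<open>S\<close>, \<open>D\<close> and \<open>F\<close> all scale by
    \<open>t\<close>. Half of the margin \<open>k/2\<close> goes to the quadratic part of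
    \<open>small1\<close> and half to its linear part; \<open>small3\<close> is divided by
    \<open>t\<close>.\<close>
  have c1: "eventually (\<lambda>t. t * (k\<^sub>B * \<nu>h * S\<^sup>2) < k/4) (at_right 0)"
    and c1': "eventually (\<lambda>t. t * (3/2 * k\<^sub>B\<^sup>2 * F + 4 * k\<^sub>B\<^sup>2 * S\<^sup>2 / D) < k/4) (at_right 0)"
    and c3: "eventually (\<lambda>t. t * (k\<^sub>B\<^sup>2 * S\<^sup>2 / k) < D/16) (at_right 0)"
    and c4: "eventually (\<lambda>t. \<forall>i\<in>{1..N}.
      t * (d i * (real N * k\<^sub>B^4 / k + k\<^sub>B * \<nu>h * (z i)\<^sup>2 / (2 * \<nu> i))) < k\<^sub>B\<^sup>2 / 32) (at_right 0)"
    by (intro eventually_mult_less_at_right_0 eventually_ball_finite ballI;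
        use assms(3,4) D in simp)+
  \<comment> \<open>The bound \<open>t < 1\<close> absorbs the second factor \<open>t\<close> of the
    quadratic part, as \<open>c1\<close> controls only one.\<close>
  have t01: "eventually (\<lambda>t::real. t \<in> {0<..<1}) (at_right 0)"
    by (rule eventually_at_right_real) simp
  obtain t where t: "0 < t" "t < 1" "t * (k\<^sub>B * \<nu>h * S\<^sup>2) < k/4"
      "t * (3/2 * k\<^sub>B\<^sup>2 * F + 4 * k\<^sub>B\<^sup>2 * S\<^sup>2 / D) < k/4"
      "t * (k\<^sub>B\<^sup>2 * S\<^sup>2 / k) < D/16"
      "\<And>i. i \<in> {1..N} \<Longrightarrow>
        t * (d i * (real N * k\<^sub>B^4 / k + k\<^sub>B * \<nu>h * (z i)\<^sup>2 / (2 * \<nu> i))) < k\<^sub>B\<^sup>2 / 32"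
    using eventually_happens[OF eventually_conj[OF t01 eventually_conj[OF c1 eventually_conj[OF c1'
          eventually_conj[OF c3 c4]]]]]
    by auto

  define \<delta> where "\<delta> = restrict (\<lambda>i. t * d i) {1..N}"
  have [simp]: "\<delta> i = t * d i" if "i \<in> {1..N}" for i using that by (simp add: \<delta>_def)
  have S': "(\<Sum>i=1..N. z i * \<delta> i / \<nu> i) = t * S"
    unfolding S_def sum_distrib_left by (rule sum.cong) auto
  have D': "(\<Sum>i=1..N. (z i)\<^sup>2 * \<delta> i / \<nu> i) = t * D"
    unfolding D_def sum_distrib_left by (rule sum.cong) auto
  have F': "(\<Sum>i=1..N. \<delta> i / \<nu> i) = t * F"
    unfolding F_def sum_distrib_left by (rule sum.cong) auto
  have "\<delta> \<in> equilibria_set N k\<^sub>B k z \<nu>"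
  proof (rule equilibria_setI; (unfold S' D' F' \<nu>h_def[symmetric])?)
    have "(\<Sum>i=1..N. z i * \<delta> i) = t * (\<Sum>i=1..N. z i * d i)"
      unfolding sum_distrib_left by (rule sum.cong) auto
    then show "(\<Sum>i=1..N. z i * \<delta> i) = 0" using d(2) by simp
    have "k\<^sub>B * \<nu>h * (t * S)\<^sup>2 = t * (t * (k\<^sub>B * \<nu>h * S\<^sup>2))"
      by (simp add: power2_eq_square)
    also have "\<dots> < k/4"
    proof -
      have "t * (t * (k\<^sub>B * \<nu>h * S\<^sup>2)) < t * (k/4)"
        using t(1,3) by (rule mult_strict_left_mono[rotated])
      also have "\<dots> \<le> 1 * (k/4)"
        by (rule mult_right_mono) (use t assms(4) in auto)
      finally show ?thesis by simp
    qed
    finally have "k\<^sub>B * \<nu>h * (t * S)\<^sup>2 < k/4" .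
    \<comment> \<open>In \<open>S\<^sup>2 / D\<close> one factor \<open>t\<close> cancels, so the
      whole expression is linear in \<open>t\<close>, as in \<open>c1'\<close>.\<close>
    moreover have "3/2 * k\<^sub>B\<^sup>2 * (t * F) + 4 * k\<^sub>B\<^sup>2 * (t * S)\<^sup>2 / (t * D)
        = t * (3/2 * k\<^sub>B\<^sup>2 * F + 4 * k\<^sub>B\<^sup>2 * S\<^sup>2 / D)"
      using t(1) D by (simp add: field_simps power2_eq_square)
    ultimately show "k\<^sub>B * \<nu>h * (t * S)\<^sup>2 + 3/2 * k\<^sub>B\<^sup>2 * (t * F) + 4 * k\<^sub>B\<^sup>2 * (t * S)\<^sup>2 / (t * D) < k/2"
      using t(4) by linarith
    have "k\<^sub>B\<^sup>2 * (t * S)\<^sup>2 / k = t * (t * (k\<^sub>B\<^sup>2 * S\<^sup>2 / k))"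
      by (simp add: power2_eq_square)
    also have "\<dots> < t * (D/16)"
      using t(1,5) by (rule mult_strict_left_mono[rotated])
    finally show "k\<^sub>B\<^sup>2 * (t * S)\<^sup>2 / k < t * D / 16" by simp
    show "\<delta> i * (real N * k\<^sub>B^4 / k + k\<^sub>B * \<nu>h * (z i)\<^sup>2 / (2 * \<nu> i)) < k\<^sub>B\<^sup>2 / 32"
      if "i \<in> {1..N}" for i
      using t(6)[OF that] that by (simp add: mult.assoc)
  qed (use assms(1,3,4) nu z close t(1) d(1) in \<open>auto simp: \<delta>_def \<nu>h_def\<close>)
  then show ?thesis by blast
qed

end
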